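(* Suppose that for every face column the horizontal velocities at time level $n+1$ satisfy the discretized momentum equations, that is, with $u_k=u^{n+1}_{i-\frac12,j,k}$ and the coefficients of the column $(i-\frac12,j)$, $$a_ku_{k-1}+b_ku_k+c_ku_{k+1}=d^{n+1}_{i-\frac12,j,k},\qquad 1\le k\le n_k,$$ and with $v_k=v^{n+1}_{i,j-\frac12,k}$ and the coefficients of the column $(i,j-\frac12)$, $$a_kv_{k-1}+b_kv_k+c_kv_{k+1}=d^{n+1}_{i,j-\frac12,k},\qquad 1\le k\le n_k$$ (where the terms with index $0$ and $n_k+1$ are absent since $a_1=c_{n_k}=0$). Then for all $1\le k\le n_k$, $$u_{i-\frac12,j,k}^{n+1}=\Omega^{(1)}_{i-\frac12,j,k}+\Omega^{(2)}_{i-\frac12,j,k}\left(\zeta_{i,j}^{n+1}-\zeta_{i-1,j}^{n+1}\right),$$ $$v_{i,j-\frac12,k}^{n+1}=\Omega^{(1)}_{i,j-\frac12,k}+\Omega^{(2)}_{i,j-\frac12,k}\left(\zeta_{i,j}^{n+1}-\zeta_{i,j-1}^{n+1}\right),$$ where, for each face column, the coefficients are defined by $$\Omega_k^{(1)}=\psi_k^{(1)}+e_k^n\,\Omega_{k+1}^{(1)},\quad \Omega_{n_k+1}^{(1)}=0,\qquad \Omega_k^{(2)}=\psi_k^{(2)}+e_k^n\,\Omega_{k+1}^{(2)},\quad \Omega_{n_k+1}^{(2)}=0.$$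
   Context: Setting: one time step, from level $n$ to level $n+1$, of a semi-implicit finite difference scheme on a staggered grid. Horizontal cells are indexed by $(i,j)$. Vertical layers are indexed by $k=1,\dots,n_k$ with $n_k\ge2$ ($k=1$ is the top layer, $k=n_k$ the bottom layer). The time step $\Delta t>0$, cell sizes $\Delta x,\Delta y>0$ and gravity constant $g>0$ are real constants. The real number $\zeta_{i,j}^{n+1}$ is the (unknown) free-surface elevation of cell $(i,j)$ at level $n+1$. Horizontal velocities $u_{i-\frac12,j,k}$ live on the face between cells $(i-1,j)$ and $(i,j)$, and $v_{i,j-\frac12,k}$ on the face between cells $(i,j-1)$ and $(i,j)$. A "face column" is the set of all layers at a fixed horizontal face $(i-\frac12,j)$ or $(i,j-\frac12)$. All quantities below belong to a given face column; horizontal indices are dropped when unnecessary. For each face column, $\Delta z_k>0$ is the thickness of layer $k$, $\Delta z_{k\pm\frac12}>0$ are the vertical spacings at the layer interfaces, and $\nu_{k\pm\frac12}\ge0$ are the vertical eddy viscosities at the interfaces (interface $k-\frac12$ separates layers $k-1$ and $k$). The coefficients are $$a_k=-\frac{\nu_{k-\frac12}\Delta t}{\Delta z_{k-\frac12}\Delta z_k}\ (2\le k\le n_k),\quad c_k=-\frac{\nu_{k+\frac12}\Delta t}{\Delta z_{k+\frac12}\Delta z_k}\ (1\le k\le n_k-1),\quad a_1=c_{n_k}=0,$$ $$b_k=1-(a_k+c_k).$$ The right-hand sides are $$d^{n+1}_{i-\frac12,j,k}=d'_{i-\frac12,j,k}-g\Delta t\,\frac{\zeta^{n+1}_{i,j}-\zeta^{n+1}_{i-1,j}}{\Delta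 x},\qquad d^{n+1}_{i,j-\frac12,k}=d'_{i,j-\frac12,k}-g\Delta t\,\frac{\zeta^{n+1}_{i,j}-\zeta^{n+1}_{i,j-1}}{\Delta y}.$$ Here $d'_k$ are known real numbers depending only on level-$n$ data: $d'_{i-\frac12,j,k}=u^n_{i-\frac12,j,k}+\Delta t\,Fu^n_{i-\frac12,j,k}$, to which $\Delta t\,\tau_{wx}/\Delta z_{i-\frac12,j,1}$ is added for $k=1$ and from which $\Delta t\,\tau_{bx}/\Delta z_{i-\frac12,j,n_k}$ is subtracted for $k=n_k$; and $d'_{i,j-\frac12,k}=v^n_{i,j-\frac12,k}+\Delta t\,Fv^n_{i,j-\frac12,k}$, with $\Delta t\,\tau_{wy}/\Delta z_{i,j-\frac12,1}$ added for $k=1$ and $\Delta t\,\tau_{by}/\Delta z_{i,j-\frac12,n_k}$ subtracted for $k=n_k$. The numbers $Fu^n,Fv^n$ (explicitly treated convection, Coriolis and horizontal viscosity terms), the wind stresses $\tau_{wx},\tau_{wy}$ and the bottom stresses $\tau_{bx},\tau_{by}$ (evaluated at level $n$) are given real numbers. For each face column and $1\le k\le n_k$, define recursively $$e_k^n=\frac{-c_k}{a_ke_{k-1}^n+b_k},\quad e_0^n=0,\qquad \psi_k^{(1)}=\frac{d_k'-a_k\psi_{k-1}^{(1)}}{a_ke_{k-1}^n+b_k},\quad \psi_0^{(1)}=0,$$ $$\psi^{(2)}_{i-\frac12,j,k}=\frac{-g\frac{\Delta t}{\Delta x}-a_k\psi^{(2)}_{i-\frac12,j,k-1}}{a_ke_{k-1}^n+b_k},\quad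 \psi^{(2)}_{i-\frac12,j,0}=0,$$ $$\psi^{(2)}_{i,j-\frac12,k}=\frac{-g\frac{\Delta t}{\Delta y}-a_k\psi^{(2)}_{i,j-\frac12,k-1}}{a_ke_{k-1}^n+b_k},\quad \psi^{(2)}_{i,j-\frac12,0}=0.$$ *)

theory Defs
  imports Complex_Main
begin

text \<open>
  Layers are numbered \<open>1..n\<close> from the top; the layer index has type \<^typ>\<open>nat\<close> so that index \<open>0\<close> is
  available for the initial values of the recursions. Interface fields are indexed by the layer
  above: entry \<open>k\<close> of \<open>spacing\<close> and \<open>visc\<close> belongs to the interface \<open>k + 1/2\<close> between the layers
  \<open>k\<close> and \<open>k + 1\<close>, so the interface \<open>k - 1/2\<close> has index \<open>k - 1\<close>.
\<close>

record face_column =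
  thickness :: "nat \<Rightarrow> real"      (* Delta z_k *)
  spacing   :: "nat \<Rightarrow> real"      (* Delta z_{k+1/2} *)
  visc      :: "nat \<Rightarrow> real"      (* nu_{k+1/2} *)
  vel       :: "nat \<Rightarrow> real"      (* u^n_k, resp. v^n_k *)
  forcing   :: "nat \<Rightarrow> real"      (* Fu^n_k, resp. Fv^n_k *)
  wind      :: real               (* tau_wx, resp. tau_wy *)
  bottom    :: real               (* tau_bx, resp. tau_by *)

definition admissible :: "nat \<Rightarrow> face_column \<Rightarrow> bool" where
  "admissible n C \<longleftrightarrow>
     (\<forall>k\<in>{1..n}. thickness C k > 0) \<and>
     (\<forall>k\<in>{1..<n}. spacing C k > 0 \<and> visc C k \<ge> 0)"

definition coeff_a :: "real \<Rightarrow> face_column \<Rightarrow> nat \<Rightarrow> real" where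
  "coeff_a dt C k =
     (if k \<le> 1 then 0 else - (visc C (k - 1) * dt / (spacing C (k - 1) * thickness C k)))"

definition coeff_c :: "nat \<Rightarrow> real \<Rightarrow> face_column \<Rightarrow> nat \<Rightarrow> real" where
  "coeff_c n dt C k =
     (if k \<ge> n then 0 else - (visc C k * dt / (spacing C k * thickness C k)))"

definition coeff_b :: "nat \<Rightarrow> real \<Rightarrow> face_column \<Rightarrow> nat \<Rightarrow> real" where
  "coeff_b n dt C k = 1 - (coeff_a dt C k + coeff_c n dt C k)"

definition known_rhs :: "nat \<Rightarrow> real \<Rightarrow> face_column \<Rightarrow> nat \<Rightarrow> real" where
  "known_rhs n dt C k =
     vel C k + dt * forcing C k
     + (if k = 1 then dt * wind C / thickness C 1 else 0)
     - (if k = n then dt * bottom C / thickness C n else 0)"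

text \<open>
  In the following, \<open>h\<close> is the cell size in the direction normal to the face, and \<open>dzeta\<close> the
  difference of the free-surface elevations at level \<open>n+1\<close> of the two cells adjacent to the face.
\<close>

definition rhs :: "nat \<Rightarrow> real \<Rightarrow> real \<Rightarrow> real \<Rightarrow> face_column \<Rightarrow> real \<Rightarrow> nat \<Rightarrow> real" where
  "rhs n dt g h C dzeta k = known_rhs n dt C k - g * dt * (dzeta / h)"

text \<open>
  At \<open>k = 1\<close> and \<open>k = n\<close> the values \<open>w 0\<close> and \<open>w (n + 1)\<close> are multiplied by zero coefficients.
\<close>

definition momentum_equations ::
  "nat \<Rightarrow> real \<Rightarrow> real \<Rightarrow> real \<Rightarrow> face_column \<Rightarrow> real \<Rightarrow> (nat \<Rightarrow> real) \<Rightarrow> bool" where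
  "momentum_equations n dt g h C dzeta w \<longleftrightarrow>
     (\<forall>k\<in>{1..n}. coeff_a dt C k * w (k - 1) + coeff_b n dt C k * w k
        + coeff_c n dt C k * w (k + 1) = rhs n dt g h C dzeta k)"

primrec elim :: "nat \<Rightarrow> real \<Rightarrow> face_column \<Rightarrow> nat \<Rightarrow> real" where
  "elim n dt C 0 = 0"
| "elim n dt C (Suc k) =
     - coeff_c n dt C (Suc k) / (coeff_a dt C (Suc k) * elim n dt C k + coeff_b n dt C (Suc k))"

primrec psi1 :: "nat \<Rightarrow> real \<Rightarrow> face_column \<Rightarrow> nat \<Rightarrow> real" where
  "psi1 n dt C 0 = 0"
| "psi1 n dt C (Suc k) =
     (known_rhs n dt C (Suc k) - coeff_a dt C (Suc k) * psi1 n dt C k)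
       / (coeff_a dt C (Suc k) * elim n dt C k + coeff_b n dt C (Suc k))"

primrec psi2 :: "nat \<Rightarrow> real \<Rightarrow> real \<Rightarrow> real \<Rightarrow> face_column \<Rightarrow> nat \<Rightarrow> real" where
  "psi2 n dt g h C 0 = 0"
| "psi2 n dt g h C (Suc k) =
     (- g * (dt / h) - coeff_a dt C (Suc k) * psi2 n dt g h C k)
       / (coeff_a dt C (Suc k) * elim n dt C k + coeff_b n dt C (Suc k))"

function back_recursion :: "nat \<Rightarrow> (nat \<Rightarrow> real) \<Rightarrow> (nat \<Rightarrow> real) \<Rightarrow> nat \<Rightarrow> real" where
  "back_recursion n e p k =
     (if k > n then 0 else p k + e k * back_recursion n e p (k + 1))"
  by pat_completeness auto
termination
  by (relation "measure (\<lambda>(n, e, p, k). Suc n - k)") auto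

declare back_recursion.simps [simp del]

definition Omega1 :: "nat \<Rightarrow> real \<Rightarrow> face_column \<Rightarrow> nat \<Rightarrow> real" where
  "Omega1 n dt C = back_recursion n (elim n dt C) (psi1 n dt C)"

definition Omega2 :: "nat \<Rightarrow> real \<Rightarrow> real \<Rightarrow> real \<Rightarrow> face_column \<Rightarrow> nat \<Rightarrow> real" where
  "Omega2 n dt g h C = back_recursion n (elim n dt C) (psi2 n dt g h C)"

lemma Omega1_rec:
  "Omega1 n dt C (n + 1) = 0"
  "k \<le> n \<Longrightarrow> Omega1 n dt C k = psi1 n dt C k + elim n dt C k * Omega1 n dt C (k + 1)"
  unfolding Omega1_def by (subst back_recursion.simps, simp)+

lemma Omega2_rec:
  "Omega2 n dt g h C (n + 1) = 0"
  "k \<le> n \<Longrightarrow>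
     Omega2 n dt g h C k = psi2 n dt g h C k + elim n dt C k * Omega2 n dt g h C (k + 1)"
  unfolding Omega2_def by (subst back_recursion.simps, simp)+

end

theory Submission
  imports Defs
begin

text \<open>
  Each face column is a tridiagonal system whose right-hand side is affine in the jump of the
  free-surface elevation across the face, and the recursions for \<^const>\<open>elim\<close>,
  \<^const>\<open>psi1\<close> and \<^const>\<open>psi2\<close> are Gaussian elimination
  (the Thomas algorithm) applied separately to the two parts of that right-hand side.

  The only analytic point is that no pivot vanishes. Since the off-diagonal coefficients are
  nonpositive and every row sums to \<open>1\<close>, the pivot of row \<open>k\<close> equals
  \<open>(1 - c) - a * (1 - e)\<close>, where \<open>e\<close> is the elimination factor of row \<open>k - 1\<close>. As long as
  \<open>e \<le> 1\<close> this is at least \<open>1 - c > 0\<close>, and then the next factor, \<open>-c\<close> divided by the pivot, lies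
  again in \<open>[0, 1]\<close> (\<open>elim_bounds\<close>).

  With nonzero pivots, eliminating downwards turns the system into the bidiagonal relations
  \<open>w k = psi1 k + psi2 k * dzeta + e k * w (k + 1)\<close> (\<open>forward_elimination\<close>). In the bottom row
  \<open>e n = 0\<close>, so the relations can be resolved upwards from there. The recursions for
  \<^const>\<open>Omega1\<close> and \<^const>\<open>Omega2\<close> are this back substitution for the part that does
  not depend on \<open>dzeta\<close> and for the coefficient of \<open>dzeta\<close>.
\<close>

lemma coeff_a_nonpos:
  assumes "admissible n C" "dt \<ge> 0" "k \<le> n"
  shows "coeff_a dt C k \<le> 0"
proof (cases "k \<le> 1")
  case False
  then have "k - 1 \<in> {1..<n}" "k \<in> {1..n}"
    using assms(3) by auto
  then have "spacing C (k - 1) > 0" "visc C (k - 1) \<ge> 0" "thickness C k > 0"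
    using assms(1) unfolding admissible_def by blast+
  then show ?thesis
    using assms(2) by (simp add: coeff_a_def)
qed (simp add: coeff_a_def)

lemma coeff_c_nonpos:
  assumes "admissible n C" "dt \<ge> 0" "1 \<le> k"
  shows "coeff_c n dt C k \<le> 0"
proof (cases "k \<ge> n")
  case False
  then have "k \<in> {1..<n}" "k \<in> {1..n}"
    using assms(3) by auto
  then have "spacing C k > 0" "visc C k \<ge> 0" "thickness C k > 0"
    using assms(1) unfolding admissible_def by blast+
  then show ?thesis
    using assms(2) by (simp add: coeff_c_def)
qed (simp add: coeff_c_def)

text \<open>
  The unit row sums enter here: replacing \<open>b\<close> by \<open>1 - a - c\<close> turns the pivot into
  \<open>1 - c - a * (1 - e)\<close>, and the last term can only increase it.
\<close>

lemma pivot_ge: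
  assumes "admissible n C" "dt \<ge> 0" "k \<le> n" "e \<le> 1"
  shows "coeff_a dt C k * e + coeff_b n dt C k \<ge> 1 - coeff_c n dt C k"
proof -
  have "coeff_a dt C k * (1 - e) \<le> 0"
    using coeff_a_nonpos[OF assms(1-3)] assms(4) by (simp add: mult_nonpos_nonneg)
  then show ?thesis
    by (simp add: coeff_b_def algebra_simps)
qed

lemma elim_bounds:
  assumes "admissible n C" "dt \<ge> 0" "k \<le> n"
  shows "0 \<le> elim n dt C k \<and> elim n dt C k \<le> 1"
  using assms(3)
proof (induction k)
  case (Suc k)
  let ?c = "coeff_c n dt C (Suc k)"
  let ?D = "coeff_a dt C (Suc k) * elim n dt C k + coeff_b n dt C (Suc k)"
  have "?c \<le> 0"
    using coeff_c_nonpos[OF assms(1,2)] by simp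
  moreover have "?D \<ge> 1 - ?c"
    using Suc pivot_ge[OF assms(1,2)] by simp
  ultimately have "0 \<le> - ?c" "- ?c \<le> ?D" "0 < ?D"
    by linarith+
  then have "0 \<le> - ?c / ?D" "- ?c / ?D \<le> 1"
    by (simp_all only: divide_le_eq_1_pos divide_nonneg_pos)
  then show ?case
    by simp
qed simp

lemma pivot_pos:
  assumes "admissible n C" "dt \<ge> 0" "Suc k \<le> n"
  shows "coeff_a dt C (Suc k) * elim n dt C k + coeff_b n dt C (Suc k) > 0"
proof -
  have "elim n dt C k \<le> 1"
    using elim_bounds[OF assms(1,2)] assms(3) by simp
  from pivot_ge[OF assms this] coeff_c_nonpos[OF assms(1,2), of "Suc k"]
  show ?thesis
    by simp
qed

text \<open>
  Substituting the relation for row \<open>k - 1\<close> into row \<open>k\<close> removes \<open>w (k - 1)\<close> and leaves the pivot in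
  front of \<open>w k\<close>; the top row has nothing to substitute because its lower coefficient is zero.
\<close>

lemma forward_elimination:
  assumes adm: "admissible n C" and dt: "dt \<ge> 0"
    and eqs: "momentum_equations n dt g h C dzeta w"
    and "1 \<le> k" "k \<le> n"
  shows "w k = psi1 n dt C k + psi2 n dt g h C k * dzeta + elim n dt C k * w (k + 1)"
proof -
  define S where "S k = psi1 n dt C k + psi2 n dt g h C k * dzeta" for k
  have step: "w (Suc m) = S (Suc m) + elim n dt C (Suc m) * w (Suc (Suc m))"
    if m: "Suc m \<le> n"
      and prev: "coeff_a dt C (Suc m) * w m
        = coeff_a dt C (Suc m) * (S m + elim n dt C m * w (Suc m))" for m
  proof -
    let ?k = "Suc m"
    let ?a = "coeff_a dt C ?k" and ?c = "coeff_c n dt C ?k"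
    let ?D = "?a * elim n dt C m + coeff_b n dt C ?k"
    have D: "?D \<noteq> 0"
      using pivot_pos[OF adm dt m] by simp
    have "?a * w m + coeff_b n dt C ?k * w ?k + ?c * w (Suc ?k) = rhs n dt g h C dzeta ?k"
      using bspec[OF eqs[unfolded momentum_equations_def], of ?k] m by simp
    with prev have "?D * w ?k = rhs n dt g h C dzeta ?k - ?a * S m - ?c * w (Suc ?k)"
      by (simp add: algebra_simps)
    then have "w ?k = (rhs n dt g h C dzeta ?k - ?a * S m - ?c * w (Suc ?k)) / ?D"
      using D by (simp add: eq_divide_eq mult.commute)
    also have "rhs n dt g h C dzeta ?k - ?a * S m - ?c * w (Suc ?k)
        = (known_rhs n dt C ?k - ?a * psi1 n dt C m)
          + (- g * (dt / h) - ?a * psi2 n dt g h C m) * dzeta + - ?c * w (Suc ?k)"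
      by (simp add: S_def rhs_def algebra_simps)
    also have "\<dots> / ?D = S ?k + elim n dt C ?k * w (Suc ?k)"
      by (simp only: S_def psi1.simps(2) psi2.simps(2) elim.simps(2) add_divide_distrib
          times_divide_eq_left)
    finally show ?thesis .
  qed
  have "w (Suc m) = S (Suc m) + elim n dt C (Suc m) * w (Suc (Suc m))" if "Suc m \<le> n" for m
    using that
  proof (induction m)
    case 0
    have "coeff_a dt C (Suc 0) * w 0 = coeff_a dt C (Suc 0) * (S 0 + elim n dt C 0 * w (Suc 0))"
      by (simp add: coeff_a_def)
    with 0 show ?case
      by (rule step)
  next
    case (Suc m)
    then have "w (Suc m) = S (Suc m) + elim n dt C (Suc m) * w (Suc (Suc m))"
      by simp
    then show ?case
      by (intro step[OF Suc.prems] arg_cong[where f = "(*) _"])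
  qed
  from this[of "k - 1"] show ?thesis
    using assms(4,5) by (simp add: S_def)
qed

lemma elim_bottom:
  assumes "n > 0"
  shows "elim n dt C n = 0"
  using assms by (cases n) (simp_all add: coeff_c_def)

text \<open>
  Back substitution. The horizontal coupling enters a column only through \<open>dzeta\<close>, so each column
  can be solved separately, with \<open>h\<close> the cell size in either horizontal direction.
\<close>

lemma column_velocity_affine:
  assumes adm: "admissible n C" and dt: "dt \<ge> 0"
    and eqs: "momentum_equations n dt g h C dzeta w"
    and "1 \<le> k" "k \<le> n"
  shows "w k = Omega1 n dt C k + Omega2 n dt g h C k * dzeta"
  using \<open>k \<le> n\<close> \<open>1 \<le> k\<close>
proof (induction rule: inc_induct)
  case base
  \<comment> \<open>The equations leave \<open>w (n + 1)\<close> unconstrained; the factor \<open>elim n dt C n = 0\<close> discards it.\<close>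
  then show ?case
    using forward_elimination[OF adm dt eqs, of n]
    by (simp add: Omega1_rec(2) Omega2_rec(2) elim_bottom)
next
  case (step m)
  then have "w m = psi1 n dt C m + psi2 n dt g h C m * dzeta
      + elim n dt C m * (Omega1 n dt C (Suc m) + Omega2 n dt g h C (Suc m) * dzeta)"
    using forward_elimination[OF adm dt eqs, of m] by simp
  then show ?case
    using step.hyps by (simp add: Omega1_rec(2) Omega2_rec(2) algebra_simps)
qed

theorem lemma2:
  fixes n :: nat and dt dx dy g :: real
    and XF YF :: "(int \<times> int) set"
    and X Y :: "int \<Rightarrow> int \<Rightarrow> face_column"
    and zeta :: "int \<Rightarrow> int \<Rightarrow> real"
    and u v :: "int \<Rightarrow> int \<Rightarrow> nat \<Rightarrow> real"
  assumes "n \<ge> 2" and "dt > 0" and "dx > 0" and "dy > 0" and "g > 0"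
    and "\<And>i j. (i, j) \<in> XF \<Longrightarrow> admissible n (X i j)"
    and "\<And>i j. (i, j) \<in> YF \<Longrightarrow> admissible n (Y i j)"
    and "\<And>i j. (i, j) \<in> XF \<Longrightarrow>
      momentum_equations n dt g dx (X i j) (zeta i j - zeta (i - 1) j) (u i j)"
    and "\<And>i j. (i, j) \<in> YF \<Longrightarrow>
      momentum_equations n dt g dy (Y i j) (zeta i j - zeta i (j - 1)) (v i j)"
  shows "(\<forall>(i, j)\<in>XF. \<forall>k\<in>{1..n}.
            u i j k = Omega1 n dt (X i j) k
              + Omega2 n dt g dx (X i j) k * (zeta i j - zeta (i - 1) j))
       \<and> (\<forall>(i, j)\<in>YF. \<forall>k\<in>{1..n}.
            v i j k = Omega1 n dt (Y i j) k
              + Omega2 n dt g dy (Y i j) k * (zeta i j - zeta i (j - 1)))"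
  using assms by (auto intro!: column_velocity_affine)

end
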